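(* Let $w$ be a weight function on the finite group $G$, and let $H$ and $K$ be subgroups of $G$. A necessary and sufficient condition for the random walk on $G$ driven by $w$ to induce a time-homogeneous Markov chain on the double cosets $H\backslash G/K$ (under the quotient map $g \mapsto HgK$) is that $w(kxHyK) = w(xHyK)$ for all $x, y \in G$ and all $k \in K$. If this condition holds, then the probability of a step from $HxK$ to $HyK$ in the quotient chain is proportional to $w(x^{-1}HyK)$.
   Context: A weight function on a finite group $G$ is a function $w : G \to \mathbb{R}_{\ge 0}$ with $w(G) > 0$, where for $S \subseteq G$ we write $w(S) = \sum_{s \in S} w(s)$. The random walk on $G$ driven by $w$ is the time-homogeneous Markov chain on $G$ in which the probability of a transition from $x$ to $y$ is $w(x^{-1}y)/w(G)$ (i.e. steps are by right multiplication by a random element chosen with probability proportional to $w$). For subgroups $H, K$, and $x,y \in G$, $k \in K$, the set $kxHyK$ is $\{kxhyk' : h \in H, k' \in K\}$. "Induces a time-homogeneous Markov chain" on the parts of a partition of the state space is meant in the strong sense: for every initial distribution of the original chain (including deterministic ones), the process obtained by recording which part the chain lies in is a time-homogeneous Markov chain, with transition probabilities not depending on the initial distribution. "Proportional" means equal up to a positive constant factor not depending on $x$ and $y$. *)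

theory Defs
  imports "HOL-Probability.Probability" "HOL-Algebra.Coset"
begin

section \<open>Time-homogeneous Markov chains on a finite state space\<close>

definition stochastic_matrix :: "'s set \<Rightarrow> ('s \<Rightarrow> 's \<Rightarrow> real) \<Rightarrow> bool" where
  "stochastic_matrix S P \<longleftrightarrow>
     finite S \<and> (\<forall>x\<in>S. (\<forall>y\<in>S. 0 \<le> P x y) \<and> (\<Sum>y\<in>S. P x y) = 1)"

text \<open>The initial distribution, i.e. the law of \<open>X 0\<close>, is left unconstrained. As usual, the Markov
  property is only required for histories of positive probability; values of \<open>P\<close> outside \<open>S \<times> S\<close>
  are irrelevant.\<close>

definition markov_chain ::
    "'w measure \<Rightarrow> 's set \<Rightarrow> ('s \<Rightarrow> 's \<Rightarrow> real) \<Rightarrow> (nat \<Rightarrow> 'w \<Rightarrow> 's) \<Rightarrow> bool" where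
  "markov_chain M S P X \<longleftrightarrow>
     prob_space M \<and> stochastic_matrix S P \<and>
     (\<forall>n. X n \<in> measurable M (count_space S)) \<and>
     (\<forall>n xs y. (\<forall>i\<le>n. xs i \<in> S) \<longrightarrow> y \<in> S \<longrightarrow>
        \<P>(\<omega> in M. \<forall>i\<le>n. X i \<omega> = xs i) > 0 \<longrightarrow>
        \<P>(\<omega> in M. X (Suc n) \<omega> = y \<bar> \<forall>i\<le>n. X i \<omega> = xs i) = P (xs n) y)"

text \<open>The chain with transition matrix \<open>P\<close> on \<open>S\<close> induces, via \<open>f\<close>, the chain with transition matrix
  \<open>Q\<close> on \<open>f ` S\<close>. Quantifying over all \<open>M\<close> and \<open>X\<close> covers all initial distributions on \<open>S\<close>, and \<open>Q\<close>
  does not depend on the initial distribution. Taking the sample space to be the type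
  \<open>nat \<Rightarrow> 's\<close> of trajectories loses no generality: every chain on \<open>S\<close> has the same law as
  the coordinate process on that type, under a suitable probability measure.\<close>

definition induces_chain ::
    "'s set \<Rightarrow> ('s \<Rightarrow> 's \<Rightarrow> real) \<Rightarrow> ('s \<Rightarrow> 't) \<Rightarrow> ('t \<Rightarrow> 't \<Rightarrow> real) \<Rightarrow> bool" where
  "induces_chain S P f Q \<longleftrightarrow>
     (\<forall>(M :: (nat \<Rightarrow> 's) measure) X.
        markov_chain M S P X \<longrightarrow> markov_chain M (f ` S) Q (\<lambda>n \<omega>. f (X n \<omega>)))"

section \<open>Random walks on finite groups and double cosets\<close>

definition weight_function :: "('a, 'm) monoid_scheme \<Rightarrow> ('a \<Rightarrow> real) \<Rightarrow> bool" where
  "weight_function G w \<longleftrightarrow> (\<forall>g\<in>carrier G. 0 \<le> w g) \<and> 0 < sum w (carrier G)"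

definition walk_prob :: "('a, 'm) monoid_scheme \<Rightarrow> ('a \<Rightarrow> real) \<Rightarrow> 'a \<Rightarrow> 'a \<Rightarrow> real" where
  "walk_prob G w x y = w (inv\<^bsub>G\<^esub> x \<otimes>\<^bsub>G\<^esub> y) / sum w (carrier G)"

definition double_coset :: "('a, 'm) monoid_scheme \<Rightarrow> 'a set \<Rightarrow> 'a set \<Rightarrow> 'a \<Rightarrow> 'a set" where
  "double_coset G H K g = (H #>\<^bsub>G\<^esub> g) <#>\<^bsub>G\<^esub> K"

end

theory Submission
  imports Defs
begin

text \<open>
  By Dynkin's criterion, a chain with matrix \<open>P\<close> lumps along \<open>f\<close>, from every initial distribution,
  iff the probability of jumping from \<open>x\<close> into a fibre of \<open>f\<close> depends on \<open>x\<close> only through \<open>f x\<close>: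
  sufficiency follows by summing over all histories in given fibres, necessity by starting the chain
  at a single point. For the walk, the probability of jumping from \<open>x\<close> into \<open>HyK\<close> is
  \<open>w (x\<^sup>-\<^sup>1HyK) / w G\<close>, which is invariant under \<open>x \<mapsto> hx\<close>; invariance under
  \<open>x \<mapsto> xk\<close> is the stated condition.
\<close>

section \<open>Events and joint laws of finite chains\<close>

lemma markov_chain_sets_Collect:
  assumes "markov_chain M S P X"
  shows "{\<omega> \<in> space M. R (X n \<omega>)} \<in> sets M"
proof -
  have "X n \<in> measurable M (count_space S)"
    using assms by (simp add: markov_chain_def)
  from measurable_sets[OF this, of "{s\<in>S. R s}"] measurable_space[OF this]
  show ?thesis
    by (auto simp: vimage_def Int_def elim!: back_subst[of "\<lambda>A. A \<in> sets M"])
qed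

lemma markov_chain_sets_history:
  assumes "markov_chain M S P X"
  shows "{\<omega> \<in> space M. \<forall>i\<le>n. R i (X i \<omega>)} \<in> sets M"
proof -
  have "{\<omega> \<in> space M. \<forall>i\<in>{..n}. R i (X i \<omega>)} \<in> sets M"
    by (rule sets.sets_Collect_finite_All') (auto intro: markov_chain_sets_Collect[OF assms])
  then show ?thesis
    by (simp only: Ball_def atMost_iff)
qed

text \<open>The product form frees the Markov property from its side condition: for a history of
  probability zero both sides vanish, because the joint event is contained in the history. Histories
  can then be summed without case distinctions.\<close>

lemma markov_chain_joint:
  assumes mc: "markov_chain M S P X" and xs: "\<And>i. i \<le> n \<Longrightarrow> xs i \<in> S" and y: "y \<in> S"
  shows "\<P>(\<omega> in M. X (Suc n) \<omega> = y \<and> (\<forall>i\<le>n. X i \<omega> = xs i))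
           = \<P>(\<omega> in M. \<forall>i\<le>n. X i \<omega> = xs i) * P (xs n) y"
proof -
  interpret prob_space M
    using mc by (simp add: markov_chain_def)
  let ?E = "\<lambda>\<omega>. \<forall>i\<le>n. X i \<omega> = xs i"
  show ?thesis
  proof (cases "\<P>(\<omega> in M. ?E \<omega>) > 0")
    case True
    with mc xs y have "\<P>(\<omega> in M. X (Suc n) \<omega> = y \<bar> ?E \<omega>) = P (xs n) y"
      by (simp add: markov_chain_def)
    with True show ?thesis
      by (simp add: cond_prob_def field_simps)
  next
    case False
    then have "\<P>(\<omega> in M. ?E \<omega>) = 0"
      by (simp add: zero_less_measure_iff)
    moreover have "\<P>(\<omega> in M. X (Suc n) \<omega> = y \<and> ?E \<omega>) \<le> \<P>(\<omega> in M. ?E \<omega>)"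
      by (intro finite_measure_mono markov_chain_sets_history[OF mc]) auto
    ultimately show ?thesis
      by (simp add: antisym)
  qed
qed

text \<open>Splitting the next step over the finitely many states \<open>z\<close> of the fibre
  reduces this to \<open>markov_chain_joint\<close>. The past is still known exactly and only the
  next state is blurred, an intermediate stage between the chain and its image.\<close>

lemma markov_chain_joint_image:
  assumes mc: "markov_chain M S P X" and xs: "\<And>i. i \<le> n \<Longrightarrow> xs i \<in> S"
  shows "\<P>(\<omega> in M. f (X (Suc n) \<omega>) = B \<and> (\<forall>i\<le>n. X i \<omega> = xs i))
           = \<P>(\<omega> in M. \<forall>i\<le>n. X i \<omega> = xs i) * (\<Sum>z\<in>{z\<in>S. f z = B}. P (xs n) z)"
proof -
  interpret prob_space M
    using mc by (simp add: markov_chain_def)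
  have "finite S"
    using mc by (simp add: markov_chain_def stochastic_matrix_def)
  have "X n \<in> measurable M (count_space S)" for n
    using mc by (simp add: markov_chain_def)
  from measurable_space[OF this]
  have X: "X n \<omega> \<in> S" if "\<omega> \<in> space M" for n \<omega>
    using that by simp
  have "\<P>(\<omega> in M. f (X (Suc n) \<omega>) = B \<and> (\<forall>i\<le>n. X i \<omega> = xs i))
      = (\<Sum>z\<in>{z\<in>S. f z = B}. \<P>(\<omega> in M. X (Suc n) \<omega> = z \<and> (\<forall>i\<le>n. X i \<omega> = xs i)))"
    using \<open>finite S\<close> X
    by (intro prob_sum sets.sets_Collect_conj markov_chain_sets_Collect[OF mc]
          markov_chain_sets_history[OF mc] AE_I2) auto
  also have "\<dots> = (\<Sum>z\<in>{z\<in>S. f z = B}. \<P>(\<omega> in M. \<forall>i\<le>n. X i \<omega> = xs i) * P (xs n) z)"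
    by (intro sum.cong refl markov_chain_joint[OF mc] xs) auto
  finally show ?thesis
    by (simp add: sum_distrib_left)
qed

section \<open>Dynkin's lumping criterion\<close>

text \<open>The sufficient direction. An image history is a finite disjoint union of state
  histories, and the hypothesis \<open>lump\<close> gives all of them the same probability of moving
  into \<open>B\<close>.\<close>

lemma markov_chain_lump:
  assumes mc: "markov_chain M S P X"
    and lump: "\<And>x B. x \<in> S \<Longrightarrow> B \<in> f ` S \<Longrightarrow> (\<Sum>z\<in>{z\<in>S. f z = B}. P x z) = Q (f x) B"
  shows "markov_chain M (f ` S) Q (\<lambda>n \<omega>. f (X n \<omega>))"
  unfolding markov_chain_def
proof (intro conjI allI impI)
  show ps: "prob_space M"
    using mc by (simp add: markov_chain_def)
  interpret prob_space M
    by (fact ps)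
  have P: "stochastic_matrix S P"
    using mc by (simp add: markov_chain_def)
  then have "finite S"
    by (simp add: stochastic_matrix_def)
  have meas: "X n \<in> measurable M (count_space S)" for n
    using mc by (simp add: markov_chain_def)
  have X: "X n \<omega> \<in> S" if "\<omega> \<in> space M" for n \<omega>
    using measurable_space[OF meas that] by simp
  show "stochastic_matrix (f ` S) Q"
    unfolding stochastic_matrix_def
  proof (intro conjI ballI)
    show "finite (f ` S)"
      using \<open>finite S\<close> by simp
    fix A assume "A \<in> f ` S"
    then obtain x where x: "x \<in> S" "A = f x"
      by blast
    show "0 \<le> Q A B" if "B \<in> f ` S" for B
      using P x that by (auto simp: stochastic_matrix_def simp flip: lump intro!: sum_nonneg)
    have "(\<Sum>B\<in>f ` S. Q A B) = (\<Sum>B\<in>f ` S. \<Sum>z\<in>{z\<in>S. f z = B}. P x z)"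
      using x by (simp add: lump)
    also have "\<dots> = (\<Sum>z\<in>S. P x z)"
      using \<open>finite S\<close> by (intro sum.group) auto
    finally show "(\<Sum>B\<in>f ` S. Q A B) = 1"
      using P x by (simp add: stochastic_matrix_def)
  qed
  show "(\<lambda>\<omega>. f (X n \<omega>)) \<in> measurable M (count_space (f ` S))" for n
    by (rule measurable_compose[OF meas]) auto
  fix n and As :: "nat \<Rightarrow> 'c" and B
  assume As: "\<forall>i\<le>n. As i \<in> f ` S" and B: "B \<in> f ` S"
    and pos: "\<P>(\<omega> in M. \<forall>i\<le>n. f (X i \<omega>) = As i) > 0"
  \<comment> \<open>The state histories lying over \<open>As\<close>. Extensionality of
    \<open>\<rightarrow>\<^sub>E\<close> fixes their values beyond \<open>n\<close>, so each
    trajectory over \<open>As\<close> matches exactly one member of \<open>L\<close>, as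
    \<open>prob_sum\<close> demands.\<close>
  define L where "L = {xs \<in> {..n} \<rightarrow>\<^sub>E S. \<forall>i\<le>n. f (xs i) = As i}"
  have "finite L"
    unfolding L_def using \<open>finite S\<close> by (simp add: finite_PiE)
  have L: "\<exists>!xs. xs \<in> L \<and> (\<forall>i\<le>n. X i \<omega> = xs i)"
    if "\<omega> \<in> space M" "\<forall>i\<le>n. f (X i \<omega>) = As i" for \<omega>
  proof (rule ex1I)
    show "restrict (\<lambda>i. X i \<omega>) {..n} \<in> L \<and> (\<forall>i\<le>n. X i \<omega> = restrict (\<lambda>i. X i \<omega>) {..n} i)"
      using that X by (auto simp: L_def)
    fix xs assume "xs \<in> L \<and> (\<forall>i\<le>n. X i \<omega> = xs i)"
    then show "xs = restrict (\<lambda>i. X i \<omega>) {..n}"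
      by (intro ext) (auto simp: L_def PiE_def extensional_def restrict_def)
  qed
  have "\<P>(\<omega> in M. f (X (Suc n) \<omega>) = B \<and> (\<forall>i\<le>n. f (X i \<omega>) = As i))
      = (\<Sum>xs\<in>L. \<P>(\<omega> in M. f (X (Suc n) \<omega>) = B \<and> (\<forall>i\<le>n. X i \<omega> = xs i)))"
  proof (intro prob_sum \<open>finite L\<close> sets.sets_Collect_conj markov_chain_sets_Collect[OF mc]
        markov_chain_sets_history[OF mc] AE_I2 conjI ballI impI)
    fix \<omega> assume "\<omega> \<in> space M" "f (X (Suc n) \<omega>) = B \<and> (\<forall>i\<le>n. f (X i \<omega>) = As i)"
    then show "\<exists>!xs. xs \<in> L \<and> f (X (Suc n) \<omega>) = B \<and> (\<forall>i\<le>n. X i \<omega> = xs i)"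
      using L[of \<omega>] by simp
  qed (auto simp: L_def)
  \<comment> \<open>Every \<open>xs\<close> in \<open>L\<close> ends in the fibre over
    \<open>As n\<close>, so the transition factor does not depend on \<open>xs\<close> and can be
    pulled out of the sum.\<close>
  also have "\<dots> = (\<Sum>xs\<in>L. \<P>(\<omega> in M. \<forall>i\<le>n. X i \<omega> = xs i) * Q (As n) B)"
  proof (rule sum.cong[OF refl])
    fix xs assume xs: "xs \<in> L"
    then have "xs i \<in> S" if "i \<le> n" for i
      using that by (auto simp: L_def)
    moreover have "f (xs n) = As n"
      using xs by (simp add: L_def)
    ultimately show "\<P>(\<omega> in M. f (X (Suc n) \<omega>) = B \<and> (\<forall>i\<le>n. X i \<omega> = xs i))
        = \<P>(\<omega> in M. \<forall>i\<le>n. X i \<omega> = xs i) * Q (As n) B"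
      using markov_chain_joint_image[OF mc, of n xs f B] lump[of "xs n" B] B by simp
  qed
  also have "\<dots> = (\<Sum>xs\<in>L. \<P>(\<omega> in M. \<forall>i\<le>n. X i \<omega> = xs i)) * Q (As n) B"
    by (simp add: sum_distrib_right)
  also have "(\<Sum>xs\<in>L. \<P>(\<omega> in M. \<forall>i\<le>n. X i \<omega> = xs i)) = \<P>(\<omega> in M. \<forall>i\<le>n. f (X i \<omega>) = As i)"
  proof (intro prob_sum[symmetric] \<open>finite L\<close>
        markov_chain_sets_history[OF mc] AE_I2 conjI ballI impI)
    fix \<omega> assume "\<omega> \<in> space M" "\<forall>i\<le>n. f (X i \<omega>) = As i"
    then show "\<exists>!xs. xs \<in> L \<and> (\<forall>i\<le>n. X i \<omega> = xs i)"
      by (rule L)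
  qed (auto simp: L_def)
  finally show "\<P>(\<omega> in M. f (X (Suc n) \<omega>) = B \<bar> \<forall>i\<le>n. f (X i \<omega>) = As i) = Q (As n) B"
    using pos by (simp add: cond_prob_def)
qed

text \<open>The necessary direction, one starting point at a time. From a deterministic start, the
  first image transition has probability \<open>Q (f x) B\<close>, while the original chain gives it
  the fibre sum.\<close>

lemma induces_chain_transition:
  fixes S :: "'s set" and M :: "(nat \<Rightarrow> 's) measure"
  assumes ind: "induces_chain S P f Q"
    and mc: "markov_chain M S P X" and start: "\<P>(\<omega> in M. X 0 \<omega> = x) = 1"
    and x: "x \<in> S" and B: "B \<in> f ` S"
  shows "(\<Sum>z\<in>{z\<in>S. f z = B}. P x z) = Q (f x) B"
proof -
  interpret prob_space M
    using mc by (simp add: markov_chain_def)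
  have ae: "AE \<omega> in M. X 0 \<omega> = x"
    using prob_Collect_eq_1[of "\<lambda>\<omega>. X 0 \<omega> = x"] start
      markov_chain_sets_Collect[OF mc, of "\<lambda>s. s = x" 0] by simp
  have mc': "markov_chain M (f ` S) Q (\<lambda>n \<omega>. f (X n \<omega>))"
    using ind mc unfolding induces_chain_def by blast
  have f1: "\<P>(\<omega> in M. f (X 0 \<omega>) = f x) = 1"
    using ae markov_chain_sets_Collect[OF mc, of "\<lambda>s. f s = f x" 0]
    by (subst prob_Collect_eq_1) auto
  have "\<P>(\<omega> in M. f (X (Suc 0) \<omega>) = B \<and> f (X 0 \<omega>) = f x) = Q (f x) B"
    using markov_chain_joint[OF mc', of 0 "\<lambda>_. f x" B] x B f1 by simp
  \<comment> \<open>Both conditions on \<open>X 0\<close> hold almost surely, so one may replace the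
    other; the exact history is what \<open>markov_chain_joint_image\<close> requires.\<close>
  moreover have "\<P>(\<omega> in M. f (X (Suc 0) \<omega>) = B \<and> f (X 0 \<omega>) = f x)
      = \<P>(\<omega> in M. f (X (Suc 0) \<omega>) = B \<and> X 0 \<omega> = x)"
    by (rule prob_eq_AE)
       (use ae in \<open>auto intro!: sets.sets_Collect_conj markov_chain_sets_Collect[OF mc]\<close>)
  moreover have "\<dots> = (\<Sum>z\<in>{z\<in>S. f z = B}. P x z)"
    using markov_chain_joint_image[OF mc, of 0 "\<lambda>_. x" f B] x start by simp
  ultimately show ?thesis
    by simp
qed

section \<open>The random walk as a running product of independent steps\<close>

context group
begin

primrec walk :: "'a \<Rightarrow> (nat \<Rightarrow> 'a) \<Rightarrow> nat \<Rightarrow> 'a" where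
  "walk x \<omega> 0 = x"
| "walk x \<omega> (Suc n) = walk x \<omega> n \<otimes> \<omega> n"

text \<open>Solving for the increments turns an event about positions \<open>0\<close> to
  \<open>n\<close> into a cylinder in the steps \<open>0\<close> to \<open>n - 1\<close>, whose
  probability a product measure computes directly.\<close>

lemma walk_eq_iff:
  assumes x: "x \<in> carrier G" and \<omega>: "\<omega> \<in> UNIV \<rightarrow> carrier G" and xs: "\<And>i. i \<le> n \<Longrightarrow> xs i \<in> carrier G"
  shows "(\<forall>i\<le>n. walk x \<omega> i = xs i)
           \<longleftrightarrow> xs 0 = x \<and> (\<forall>i<n. \<omega> i = inv (xs i) \<otimes> xs (Suc i))"
  using xs
proof (induction n)
  case 0
  then show ?case by auto
next
  case (Suc n)
  have w: "\<omega> n \<in> carrier G"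
    using \<omega> by auto
  have "(\<forall>i\<le>Suc n. walk x \<omega> i = xs i)
      \<longleftrightarrow> (\<forall>i\<le>n. walk x \<omega> i = xs i) \<and> xs n \<otimes> \<omega> n = xs (Suc n)"
    by (simp only: le_Suc_eq walk.simps) (metis le_refl walk.simps(2))
  also have "\<dots> \<longleftrightarrow> (\<forall>i\<le>n. walk x \<omega> i = xs i) \<and> \<omega> n = inv (xs n) \<otimes> xs (Suc n)"
    using Suc.prems[of n] Suc.prems[of "Suc n"] w
    by (metis inv_solve_left le_refl le_SucI)
  finally show ?case
    using Suc by (auto simp: less_Suc_eq)
qed

lemma stochastic_matrix_walk_prob:
  assumes "finite (carrier G)" and w: "weight_function G w"
  shows "stochastic_matrix (carrier G) (walk_prob G w)"
  unfolding stochastic_matrix_def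
proof (intro conjI ballI)
  fix x assume x: "x \<in> carrier G"
  show "0 \<le> walk_prob G w x y" if "y \<in> carrier G" for y
    using w x that by (auto simp: walk_prob_def weight_function_def)
  have "(\<Sum>y\<in>carrier G. w (inv x \<otimes> y)) = sum w (carrier G)"
    by (rule sum.reindex_bij_witness[of _ "\<lambda>y. x \<otimes> y" "\<lambda>y. inv x \<otimes> y"])
       (use x in \<open>auto simp flip: m_assoc\<close>)
  then show "(\<Sum>y\<in>carrier G. walk_prob G w x y) = 1"
    using w by (simp add: walk_prob_def weight_function_def flip: sum_divide_distrib)
qed (fact assms)

text \<open>\<open>induces_chain\<close> quantifies universally over chains, so it yields
  information about \<open>Q\<close> only once a chain is exhibited. A deterministic start at each
  \<open>x\<close> is what \<open>induces_chain_transition\<close> consumes.\<close>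

lemma ex_markov_chain_walk:
  assumes fin: "finite (carrier G)" and w: "weight_function G w" and x: "x \<in> carrier G"
  shows "\<exists>(M :: (nat \<Rightarrow> 'a) measure) X.
           markov_chain M (carrier G) (walk_prob G w) X \<and> \<P>(\<omega> in M. X 0 \<omega> = x) = 1"
proof -
  \<comment> \<open>the sample space carries the i.i.d. steps; \<open>X\<close> is their running product started at \<open>x\<close>\<close>
  let ?p = "\<lambda>g. w g / sum w (carrier G)"
  define N where "N = point_measure (carrier G) ?p"
  define M where "M = Pi\<^sub>M (UNIV :: nat set) (\<lambda>_. N)"
  have p_nonneg: "0 \<le> ?p g" if "g \<in> carrier G" for g
    using w that by (simp add: weight_function_def)
  have N_emeasure: "emeasure N A = (\<Sum>g\<in>A. ennreal (?p g))" if "A \<subseteq> carrier G" for A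
    unfolding N_def using fin that by (rule emeasure_point_measure_finite)
  have space_N: "space N = carrier G" and sets_N: "sets N = Pow (carrier G)"
    by (simp_all add: N_def space_point_measure sets_point_measure)
  have N: "prob_space N"
  proof
    have "emeasure N (space N) = ennreal (\<Sum>g\<in>carrier G. ?p g)"
      by (simp add: space_N N_emeasure sum_ennreal p_nonneg)
    also have "(\<Sum>g\<in>carrier G. ?p g) = 1"
      using w by (simp add: weight_function_def flip: sum_divide_distrib)
    finally show "emeasure N (space N) = 1"
      by simp
  qed
  interpret N: prob_space N
    by (fact N)
  interpret M: product_prob_space "\<lambda>_::nat. N" UNIV
    by unfold_locales
  have ps: "prob_space M"
    unfolding M_def by (rule M.P.prob_space_axioms)
  interpret prob_space M
    by (fact ps)
  have space_M: "space M = UNIV \<rightarrow> carrier G"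
    by (simp add: M_def space_PiM space_N PiE_UNIV_domain)
  have [measurable]: "(\<lambda>\<omega>. \<omega> n) \<in> measurable M (count_space (carrier G))" for n
  proof -
    have "(\<lambda>\<omega>. \<omega> n) \<in> measurable M N"
      unfolding M_def by measurable
    then show ?thesis
      by (simp add: measurable_def space_N sets_N)
  qed
  have meas: "(\<lambda>\<omega>. walk x \<omega> n) \<in> measurable M (count_space (carrier G))" for n
  proof (induction n)
    case 0
    then show ?case
      using x by simp
  next
    case (Suc n)
    have "(\<lambda>\<omega>. (walk x \<omega> n, \<omega> n)) \<in> measurable M (count_space (carrier G) \<Otimes>\<^sub>M count_space (carrier G))"
      using Suc by measurable
    \<comment> \<open>Finiteness makes the product sigma-algebra discrete, hence group
      multiplication measurable.\<close>
    also have "count_space (carrier G) \<Otimes>\<^sub>M count_space (carrier G) = count_space (carrier G \<times> carrier G)"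
      using fin by (intro pair_measure_count_space) auto
    finally have "(\<lambda>\<omega>. (\<lambda>(a, b). a \<otimes> b) (walk x \<omega> n, \<omega> n)) \<in> measurable M (count_space (carrier G))"
      by (rule measurable_compose) auto
    then show ?case
      by simp
  qed
  \<comment> \<open>The law of all finite paths; it supplies both the numerator and the denominator
    of the conditional probability below.\<close>
  have cyl: "\<P>(\<omega> in M. \<forall>i\<le>n. walk x \<omega> i = xs i)
      = (if xs 0 = x then \<Prod>i<n. walk_prob G w (xs i) (xs (Suc i)) else 0)"
    if xs: "\<And>i. i \<le> n \<Longrightarrow> xs i \<in> carrier G" for n xs
  proof (cases "xs 0 = x")
    case True
    let ?g = "\<lambda>i. inv (xs i) \<otimes> xs (Suc i)"
    have g: "?g i \<in> carrier G" if "i < n" for i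
      using that xs[of i] xs[of "Suc i"] by simp
    have "{\<omega> \<in> space M. \<forall>i\<le>n. walk x \<omega> i = xs i}
        = {\<omega> \<in> space M. \<forall>i\<in>{..<n}. \<omega> i \<in> {?g i}}"
    proof (rule Collect_cong, rule conj_cong[OF refl])
      fix \<omega> assume "\<omega> \<in> space M"
      then show "(\<forall>i\<le>n. walk x \<omega> i = xs i) \<longleftrightarrow> (\<forall>i\<in>{..<n}. \<omega> i \<in> {?g i})"
        using walk_eq_iff[OF x _ xs, of \<omega> n "\<lambda>i. i"] True by (simp add: space_M Ball_def)
    qed
    also have "emeasure M \<dots> = (\<Prod>i<n. emeasure N {?g i})"
      unfolding M_def by (rule M.emeasure_PiM_Collect) (auto simp: sets_N g)
    also have "\<dots> = (\<Prod>i<n. ennreal (?p (?g i)))"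
      by (intro prod.cong refl) (simp add: N_emeasure g)
    also have "\<dots> = ennreal (\<Prod>i<n. ?p (?g i))"
      by (rule prod_ennreal) (simp add: p_nonneg g)
    finally have "\<P>(\<omega> in M. \<forall>i\<le>n. walk x \<omega> i = xs i) = (\<Prod>i<n. ?p (?g i))"
      by (rule measure_eq_emeasure_eq_ennreal[rotated]) (intro prod_nonneg ballI p_nonneg g, simp)
    then show ?thesis
      using True by (simp add: walk_prob_def)
  next
    case False
    have "{\<omega> \<in> space M. \<forall>i\<le>n. walk x \<omega> i = xs i} = {}"
      using False by force
    with False show ?thesis
      by (simp only: measure_empty if_False)
  qed
  have "markov_chain M (carrier G) (walk_prob G w) (\<lambda>n \<omega>. walk x \<omega> n)"
    unfolding markov_chain_def
  proof (intro conjI allI impI ps meas stochastic_matrix_walk_prob fin w)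
    fix n xs y
    assume xs: "\<forall>i\<le>n. xs i \<in> carrier G" and y: "y \<in> carrier G"
      and pos: "\<P>(\<omega> in M. \<forall>i\<le>n. walk x \<omega> i = xs i) > 0"
    \<comment> \<open>Appending \<open>y\<close> to the history makes the joint event a path event
      of length \<open>Suc n\<close>, to which \<open>cyl\<close> applies.\<close>
    define ys where "ys = xs(Suc n := y)"
    have ys: "ys i \<in> carrier G" if "i \<le> Suc n" for i
      using that xs y by (auto simp: ys_def le_Suc_eq)
    have eq: "walk x \<omega> (Suc n) = y \<and> (\<forall>i\<le>n. walk x \<omega> i = xs i)
        \<longleftrightarrow> (\<forall>i\<le>Suc n. walk x \<omega> i = ys i)" for \<omega>
      unfolding ys_def by (auto simp: le_Suc_eq simp del: walk.simps)
    \<comment> \<open>Otherwise \<open>cyl\<close> would give the history probability zero,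
      contradicting \<open>pos\<close>.\<close>
    have x0: "xs 0 = x"
      using cyl[of n xs] xs pos by (simp split: if_splits)
    have "\<P>(\<omega> in M. walk x \<omega> (Suc n) = y \<and> (\<forall>i\<le>n. walk x \<omega> i = xs i))
        = (\<Prod>i<Suc n. walk_prob G w (ys i) (ys (Suc i)))"
      unfolding eq using cyl[OF ys] x0 by (simp add: ys_def)
    also have "\<dots> = (\<Prod>i<n. walk_prob G w (xs i) (xs (Suc i))) * walk_prob G w (xs n) y"
      by (simp add: ys_def)
    also have "\<dots> = \<P>(\<omega> in M. \<forall>i\<le>n. walk x \<omega> i = xs i) * walk_prob G w (xs n) y"
      using cyl[of n xs] xs x0 by simp
    finally show "\<P>(\<omega> in M. walk x \<omega> (Suc n) = y \<bar> \<forall>i\<le>n. walk x \<omega> i = xs i)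
        = walk_prob G w (xs n) y"
      using pos by (simp add: cond_prob_def del: walk.simps)
  qed
  moreover have "\<P>(\<omega> in M. walk x \<omega> 0 = x) = 1"
    by (simp add: prob_space)
  ultimately show ?thesis
    by blast
qed

section \<open>Double cosets and their translates\<close>

lemma mem_double_coset_iff:
  "z \<in> double_coset G H K g \<longleftrightarrow> (\<exists>h\<in>H. \<exists>k\<in>K. z = h \<otimes> g \<otimes> k)"
  by (auto simp: double_coset_def set_mult_def r_coset_def)

lemma double_coset_subset_carrier:
  assumes "subgroup H G" "subgroup K G" "g \<in> carrier G"
  shows "double_coset G H K g \<subseteq> carrier G"
  using assms by (auto simp: mem_double_coset_iff subgroup.mem_carrier)

lemma double_coset_absorb:
  assumes H: "subgroup H G" and K: "subgroup K G"
    and "h \<in> H" "k \<in> K" and g: "g \<in> carrier G"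
  shows "double_coset G H K (h \<otimes> g \<otimes> k) = double_coset G H K g"
proof -
  note [simp] = subgroup.mem_carrier[OF H] subgroup.mem_carrier[OF K]
  \<comment> \<open>Stated for arbitrary \<open>h\<close>, \<open>k\<close>, \<open>g\<close>, since
    the reverse inclusion is the same fact for the inverses of \<open>h\<close> and
    \<open>k\<close>.\<close>
  have sub: "double_coset G H K (h \<otimes> g \<otimes> k) \<subseteq> double_coset G H K g"
    if "h \<in> H" "k \<in> K" "g \<in> carrier G" for h k g
  proof
    fix z assume "z \<in> double_coset G H K (h \<otimes> g \<otimes> k)"
    then obtain h' k' where *: "h' \<in> H" "k' \<in> K" "z = h' \<otimes> (h \<otimes> g \<otimes> k) \<otimes> k'"
      by (auto simp: mem_double_coset_iff)
    then have "z = (h' \<otimes> h) \<otimes> g \<otimes> (k \<otimes> k')"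
      using that by (simp add: m_assoc)
    with * that show "z \<in> double_coset G H K g"
      unfolding mem_double_coset_iff
      by (meson H K subgroup.m_closed)
  qed
  have "g = inv h \<otimes> (h \<otimes> g \<otimes> k) \<otimes> inv k"
    using assms by (simp add: m_assoc) (simp add: flip: m_assoc)
  then have "double_coset G H K g \<subseteq> double_coset G H K (h \<otimes> g \<otimes> k)"
    using sub[of "inv h" "inv k" "h \<otimes> g \<otimes> k"] assms H K
    by (simp add: subgroup.m_inv_closed)
  with sub[OF assms(3-5)] show ?thesis
    by blast
qed

text \<open>Double cosets are the fibres of the quotient map, so fibre sums become sums over double
  cosets.\<close>

lemma double_coset_eq_iff:
  assumes H: "subgroup H G" and K: "subgroup K G" and "y \<in> carrier G" "z \<in> carrier G"
  shows "double_coset G H K z = double_coset G H K y \<longleftrightarrow> z \<in> double_coset G H K y"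
proof
  have "z = \<one> \<otimes> z \<otimes> \<one>"
    using assms by simp
  then have "z \<in> double_coset G H K z"
    unfolding mem_double_coset_iff using H K subgroup.one_closed by blast
  then show "double_coset G H K z = double_coset G H K y \<Longrightarrow> z \<in> double_coset G H K y"
    by simp
  show "double_coset G H K z = double_coset G H K y" if "z \<in> double_coset G H K y"
    using that assms by (auto simp: mem_double_coset_iff double_coset_absorb)
qed

lemma sum_l_coset:
  assumes "A \<subseteq> carrier G" "x \<in> carrier G"
  shows "sum w (x <# A) = (\<Sum>z\<in>A. w (x \<otimes> z))"
proof -
  have "inj_on (\<lambda>z. x \<otimes> z) A"
    using assms by (blast intro: inj_on_subset[OF inj_on_cmult])
  moreover have "x <# A = (\<lambda>z. x \<otimes> z) ` A"
    by (auto simp: l_coset_def)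
  ultimately show ?thesis
    by (simp add: sum.reindex)
qed

section \<open>Jump probabilities into double cosets\<close>

lemma sum_walk_prob_double_coset:
  assumes H: "subgroup H G" and K: "subgroup K G" and x: "x \<in> carrier G" and y: "y \<in> carrier G"
  shows "(\<Sum>z\<in>{z\<in>carrier G. double_coset G H K z = double_coset G H K y}. walk_prob G w x z)
           = sum w (inv x <# double_coset G H K y) / sum w (carrier G)"
proof -
  have "{z\<in>carrier G. double_coset G H K z = double_coset G H K y} = double_coset G H K y"
    using double_coset_eq_iff[OF H K y] double_coset_subset_carrier[OF H K y] by auto
  then show ?thesis
    using sum_l_coset[OF double_coset_subset_carrier[OF H K y], of "inv x" w] x
    by (simp add: walk_prob_def sum_divide_distrib)
qed

text \<open>Inverting places \<open>inv h\<close> directly to the left of HyK, and left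
  multiplication by an element of \<open>H\<close> preserves HyK. Changing the representative of HxK
  thus leaves only a factor from \<open>K\<close>, the one that the weight condition
  controls.\<close>

lemma l_coset_double_coset_absorb:
  assumes H: "subgroup H G" and K: "subgroup K G" and "h \<in> H" "k \<in> K"
    and x: "x \<in> carrier G" and y: "y \<in> carrier G"
  shows "inv (h \<otimes> x \<otimes> k) <# double_coset G H K y = (inv k \<otimes> inv x) <# double_coset G H K y"
proof -
  note [simp] = subgroup.mem_carrier[OF H] subgroup.mem_carrier[OF K]
  have "inv h <# double_coset G H K y = double_coset G H K y"
  proof -
    have "h' <# double_coset G H K y \<subseteq> double_coset G H K y" if h': "h' \<in> H" for h'
    proof
      fix z assume "z \<in> h' <# double_coset G H K y"
      then obtain a b where ab: "a \<in> H" "b \<in> K" "z = h' \<otimes> (a \<otimes> y \<otimes> b)"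
        by (auto simp: l_coset_def mem_double_coset_iff)
      then have "z = (h' \<otimes> a) \<otimes> y \<otimes> b"
        using h' y by (simp add: m_assoc)
      with ab h' show "z \<in> double_coset G H K y"
        unfolding mem_double_coset_iff by (meson H subgroup.m_closed)
    qed
    note sub = this
    have "z \<in> inv h <# double_coset G H K y" if z: "z \<in> double_coset G H K y" for z
    proof -
      have "z \<in> carrier G"
        using z double_coset_subset_carrier[OF H K y] by blast
      then have "z = inv h \<otimes> (h \<otimes> z)"
        using \<open>h \<in> H\<close> by (simp flip: m_assoc)
      moreover have "h \<otimes> z \<in> double_coset G H K y"
        using sub[OF \<open>h \<in> H\<close>] z by (auto simp: l_coset_def)
      ultimately show ?thesis
        unfolding l_coset_def by blast
    qed
    with sub[OF subgroup.m_inv_closed[OF H \<open>h \<in> H\<close>]] show ?thesis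
      by blast
  qed
  moreover have "inv (h \<otimes> x \<otimes> k) = (inv k \<otimes> inv x) \<otimes> inv h"
    using assms by (simp add: inv_mult_group m_assoc)
  moreover have "((inv k \<otimes> inv x) \<otimes> inv h) <# double_coset G H K y
      = (inv k \<otimes> inv x) <# (inv h <# double_coset G H K y)"
    using assms double_coset_subset_carrier[OF H K y] by (intro lcos_m_assoc[symmetric]) auto
  ultimately show ?thesis
    by simp
qed

text \<open>The induced matrix is forced on double cosets, with the same value for every
  representative \<open>x\<close>. This serves both the necessity of the condition and the formula
  for the quotient chain.\<close>

lemma induces_chain_walk_prob_double_coset:
  assumes fin: "finite (carrier G)" and w: "weight_function G w"
    and H: "subgroup H G" and K: "subgroup K G"
    and ind: "induces_chain (carrier G) (walk_prob G w) (double_coset G H K) Q"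
    and x: "x \<in> carrier G" and y: "y \<in> carrier G"
  shows "Q (double_coset G H K x) (double_coset G H K y)
           = sum w (inv x <# double_coset G H K y) / sum w (carrier G)"
proof -
  obtain M :: "(nat \<Rightarrow> 'a) measure" and X where
    "markov_chain M (carrier G) (walk_prob G w) X" "\<P>(\<omega> in M. X 0 \<omega> = x) = 1"
    using ex_markov_chain_walk[OF fin w x] by blast
  from induces_chain_transition[OF ind this x imageI[OF y]]
  show ?thesis
    by (simp add: sum_walk_prob_double_coset[OF H K x y])
qed

end

section \<open>The lumping criterion for double cosets\<close>

theorem theorem1p1:
  fixes G :: "('a, 'm) monoid_scheme" (structure)
    and w :: "'a \<Rightarrow> real" and H K :: "'a set"
  assumes "group G" and "finite (carrier G)"
    and "weight_function G w"
    and "subgroup H G" and "subgroup K G"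
  shows "((\<exists>Q. induces_chain (carrier G) (walk_prob G w) (double_coset G H K) Q) \<longleftrightarrow>
            (\<forall>x\<in>carrier G. \<forall>y\<in>carrier G. \<forall>k\<in>K.
               sum w ((k \<otimes> x) <# double_coset G H K y) = sum w (x <# double_coset G H K y)))
       \<and> ((\<forall>x\<in>carrier G. \<forall>y\<in>carrier G. \<forall>k\<in>K.
               sum w ((k \<otimes> x) <# double_coset G H K y) = sum w (x <# double_coset G H K y)) \<longrightarrow>
            (\<exists>c>0. \<forall>Q. induces_chain (carrier G) (walk_prob G w) (double_coset G H K) Q \<longrightarrow>
               (\<forall>x\<in>carrier G. \<forall>y\<in>carrier G.
                  Q (double_coset G H K x) (double_coset G H K y)
                    = c * sum w (inv x <# double_coset G H K y))))"
proof -
  interpret group G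
    by (fact assms)
  let ?f = "double_coset G H K"
  let ?W = "sum w (carrier G)"
  let ?cond = "\<forall>x\<in>carrier G. \<forall>y\<in>carrier G. \<forall>k\<in>K. sum w ((k \<otimes> x) <# ?f y) = sum w (x <# ?f y)"
  let ?ind = "induces_chain (carrier G) (walk_prob G w) ?f"
  note H = \<open>subgroup H G\<close> and K = \<open>subgroup K G\<close>
  note transition = induces_chain_walk_prob_double_coset[OF assms(2-5)]
  have W: "?W > 0"
    using assms(3) by (simp add: weight_function_def)
  have necessary: ?cond if ind: "?ind Q" for Q
  proof (intro ballI)
    fix x y k
    assume x: "x \<in> carrier G" and y: "y \<in> carrier G" and k: "k \<in> K"
    have kc: "k \<in> carrier G"
      by (rule subgroup.mem_carrier[OF K k])
    \<comment> \<open>\<open>inv (k \<otimes> x)\<close> equals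
      \<open>inv x \<otimes> inv k\<close>, so both inverses represent one double coset;
      \<open>transition\<close> at these two points compares the two weights.\<close>
    have "?f (\<one> \<otimes> inv x \<otimes> inv k) = ?f (inv x)"
      using x k H K by (intro double_coset_absorb) (auto simp: subgroup.one_closed subgroup.m_inv_closed)
    then have "?f (inv (k \<otimes> x)) = ?f (inv x)"
      using x kc by (simp add: inv_mult_group)
    then show "sum w ((k \<otimes> x) <# ?f y) = sum w (x <# ?f y)"
      using transition[OF ind _ y, of "inv (k \<otimes> x)"] transition[OF ind _ y, of "inv x"] x kc W by simp
  qed
  have sufficient: "\<exists>Q. ?ind Q" if cond: ?cond
  proof -
    \<comment> \<open>\<open>?Q\<close> is read off from a chosen representative \<open>?r A\<close>
      of each double coset; the condition makes the fibre sum independent of that choice.\<close>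
    let ?r = "\<lambda>A. SOME x. x \<in> carrier G \<and> ?f x = A"
    let ?Q = "\<lambda>A B. \<Sum>z\<in>{z\<in>carrier G. ?f z = B}. walk_prob G w (?r A) z"
    have "(\<Sum>z\<in>{z\<in>carrier G. ?f z = B}. walk_prob G w x z) = ?Q (?f x) B"
      if x: "x \<in> carrier G" and B: "B \<in> ?f ` carrier G" for x B
    proof -
      from B obtain y where y: "y \<in> carrier G" and By: "B = ?f y"
        by (rule imageE)
      have r: "?r (?f x) \<in> carrier G \<and> ?f (?r (?f x)) = ?f x"
        by (rule someI) (use x in blast)
      then have "?r (?f x) \<in> ?f x"
        using double_coset_eq_iff[OF H K x] by blast
      then obtain h k where hk: "h \<in> H" "k \<in> K" "?r (?f x) = h \<otimes> x \<otimes> k"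
        by (auto simp: mem_double_coset_iff)
      \<comment> \<open>After \<open>h\<close> is absorbed, \<open>cond\<close> is applied with
        \<open>inv k\<close> in \<open>K\<close> and \<open>inv x\<close> in the group.\<close>
      then have "sum w (inv (?r (?f x)) <# ?f y) = sum w (inv x <# ?f y)"
        using l_coset_double_coset_absorb[OF H K hk(1,2) x y] cond x y
          subgroup.m_inv_closed[OF K hk(2)] by simp
      then show ?thesis
        using r x y H K by (simp add: By sum_walk_prob_double_coset)
    qed
    then have "?ind ?Q"
      unfolding induces_chain_def by (intro allI impI markov_chain_lump)
    then show ?thesis
      by blast
  qed
  have "\<exists>c>0. \<forall>Q. ?ind Q \<longrightarrow>
      (\<forall>x\<in>carrier G. \<forall>y\<in>carrier G. Q (?f x) (?f y) = c * sum w (inv x <# ?f y))"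
    \<comment> \<open>The constant of proportionality is the reciprocal of the total weight, the
      same for every \<open>Q\<close>.\<close>
    using W transition by (intro exI[of _ "1 / ?W"]) simp
  with necessary sufficient show ?thesis
    by blast
qed

end
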